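(* Let $\pi:X\to Y$ be a homomorphism of minimal dynamical systems $(X,T)$ and $(Y,T)$. If $Y$ contains a uniformly chaotic subset, then so does $X$.
   Context: A dynamical system $(X,T)$ is here a nonempty compact metric space $(X,d)$ with a homeomorphism $T:X\to X$ (the acting map on every system is denoted $T$). It is minimal if it has no proper nonempty closed $T$-invariant subset. A homomorphism $\pi:X\to Y$ is a continuous surjection with $\pi\circ T=T\circ\pi$. A subset $K\subseteq X$ is rigid if there is a sequence $n_k\nearrow+\infty$ with $\lim_k T^{n_k}x=x$ for every $x\in K$. It is uniformly rigid if for every $\epsilon>0$ there is an integer $n\ge 1$ with $d(T^nx,x)<\epsilon$ for all $x\in K$. It is uniformly proximal if for every $\epsilon>0$ there is $n\in\mathbb Z_+$ with $\mathrm{diam}\,T^nK<\epsilon$. It is proximal if every finite subset of $K$ is uniformly proximal. A subset $K\subseteq X$ is a uniformly chaotic set if there are Cantor sets $C_1\subseteq C_2\subseteq\cdots$ such that $K=\bigcup_{n}C_n$ is a rigid and a proximal subset of $X$, and each $C_N$ is uniformly rigid and uniformly proximal. *)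

theory Defs
  imports "HOL-Analysis.Analysis"
begin

text \<open>
  A system is a carrier set \<open>X\<close> in a metric space type together with a map \<open>T\<close> whose values
  outside \<open>X\<close> are irrelevant.
\<close>

definition dynamical_system :: "'a::metric_space set \<Rightarrow> ('a \<Rightarrow> 'a) \<Rightarrow> bool" where
  "dynamical_system X T \<longleftrightarrow> X \<noteq> {} \<and> compact X \<and> (\<exists>T'. homeomorphism X X T T')"

text \<open>
  Invariance is \<open>T ` A = A\<close>, as is usual for homeomorphisms. Requiring only \<open>T ` A \<subseteq> A\<close>
  would give the same minimal systems, since \<open>A\<close> is compact. As \<open>X\<close> is compact,
  being closed and being closed relative to \<open>X\<close> coincide for subsets of \<open>X\<close>.
\<close>

definition minimal_system :: "'a::metric_space set \<Rightarrow> ('a \<Rightarrow> 'a) \<Rightarrow> bool" where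
  "minimal_system X T \<longleftrightarrow>
     dynamical_system X T \<and>
     (\<forall>A. A \<subseteq> X \<and> closed A \<and> A \<noteq> {} \<and> T ` A = A \<longrightarrow> A = X)"

definition system_hom ::
  "'a::metric_space set \<Rightarrow> ('a \<Rightarrow> 'a) \<Rightarrow> 'b::metric_space set \<Rightarrow> ('b \<Rightarrow> 'b) \<Rightarrow> ('a \<Rightarrow> 'b) \<Rightarrow> bool" where
  "system_hom X T Y S \<pi> \<longleftrightarrow>
     continuous_on X \<pi> \<and> \<pi> ` X = Y \<and> (\<forall>x\<in>X. \<pi> (T x) = S (\<pi> x))"

definition rigid_set :: "('a::metric_space \<Rightarrow> 'a) \<Rightarrow> 'a set \<Rightarrow> bool" where
  "rigid_set T K \<longleftrightarrow>
     (\<exists>n :: nat \<Rightarrow> nat. mono n \<and> filterlim n at_top sequentially \<and>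
        (\<forall>x\<in>K. (\<lambda>k. (T ^^ n k) x) \<longlonglongrightarrow> x))"

definition uniformly_rigid_set :: "('a::metric_space \<Rightarrow> 'a) \<Rightarrow> 'a set \<Rightarrow> bool" where
  "uniformly_rigid_set T K \<longleftrightarrow>
     (\<forall>\<epsilon>>0. \<exists>n::nat. n \<ge> 1 \<and> (\<forall>x\<in>K. dist ((T ^^ n) x) x < \<epsilon>))"

definition uniformly_proximal_set :: "('a::metric_space \<Rightarrow> 'a) \<Rightarrow> 'a set \<Rightarrow> bool" where
  "uniformly_proximal_set T K \<longleftrightarrow> (\<forall>\<epsilon>>0. \<exists>n::nat. diameter ((T ^^ n) ` K) < \<epsilon>)"

definition proximal_set :: "('a::metric_space \<Rightarrow> 'a) \<Rightarrow> 'a set \<Rightarrow> bool" where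
  "proximal_set T K \<longleftrightarrow> (\<forall>F. finite F \<and> F \<subseteq> K \<longrightarrow> uniformly_proximal_set T F)"

text \<open>
  The type \<open>nat \<Rightarrow> bool\<close> carries the product topology of discrete two-point spaces,
  so its universe is the Cantor space.
\<close>

definition cantor_set :: "'a::metric_space set \<Rightarrow> bool" where
  "cantor_set C \<longleftrightarrow> C homeomorphic (UNIV :: (nat \<Rightarrow> bool) set)"

definition uniformly_chaotic_set :: "'a::metric_space set \<Rightarrow> ('a \<Rightarrow> 'a) \<Rightarrow> 'a set \<Rightarrow> bool" where
  "uniformly_chaotic_set X T K \<longleftrightarrow>
     K \<subseteq> X \<and>
     (\<exists>C :: nat \<Rightarrow> 'a set.
        (\<forall>n. cantor_set (C n)) \<and> (\<forall>n. C n \<subseteq> C (Suc n)) \<and> K = (\<Union>n. C n) \<and>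
        rigid_set T K \<and> proximal_set T K \<and>
        (\<forall>n. uniformly_rigid_set T (C n) \<and> uniformly_proximal_set T (C n)))"

end

theory Submission
  imports Defs
begin

text \<open>
  The uniformly chaotic set of \<open>Y\<close> need not lie where \<open>\<pi>\<close> has good sections, and it may
  have no continuous lift to \<open>X\<close>. The idea is to lift one of its Cantor sets \<open>C\<close> merely as a set,
  but coherently, and to rebuild a Cantor set inside \<open>X\<close> afterwards.

  The lift uses pointwise limits of iterates of \<open>T\<close>, that is, the Ellis semigroup of \<open>X\<close>. Such
  limits act on \<open>Y\<close> as well, because they respect the fibres of \<open>\<pi>\<close>. Rigidity of \<open>C\<close> makes the
  limits along times tending to infinity that fix every point of \<open>C\<close> a nonempty compact semigroup,
  so some idempotent \<open>u\<close> fixes \<open>C\<close> pointwise (\<open>rigid_idempotent\<close>). Proximality of \<open>C\<close> gives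
  limits that collapse \<open>C\<close> to a point (\<open>collapsing_map\<close>). These contain a minimal left ideal \<open>M\<close>
  whose elements \<open>p\<close> all satisfy \<open>p \<circ> u = p\<close>. Since \<open>X\<close> is minimal, every point of \<open>X\<close> is fixed by
  some idempotent of \<open>M\<close>. Let \<open>w\<close> be an idempotent of \<open>M\<close> and \<open>z\<close> a point of \<open>w X\<close> over the
  point to which \<open>w\<close> collapses \<open>C\<close>. For \<open>y\<close> in \<open>C\<close> take an idempotent \<open>v\<close> of \<open>M\<close> that fixes a point
  over \<open>y\<close>. Idempotents of \<open>M\<close> are right identities of \<open>M\<close>, so \<open>v \<circ> w = v\<close>, and \<open>v\<close> collapses \<open>C\<close>
  to \<open>y\<close>; hence \<open>v z\<close> lies over \<open>y\<close>, and so does \<open>x y = u (v z)\<close>. Moreover \<open>u\<close> fixes \<open>x y\<close>, and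
  \<open>w (x y) = w (v z) = w z = z\<close>. So one map \<open>u\<close> fixes all the points \<open>x y\<close> and one map \<open>w\<close> sends
  all of them to \<open>z\<close> (\<open>coherent_lift\<close>).

  Consequently every finite subset of the uncountable set \<open>D = {x y | y \<in> C}\<close> is moved back near
  itself at arbitrarily late times, and is moved near \<open>z\<close> at other times. At a fixed precision both
  properties persist on a neighbourhood of the finite set and pass to subsets. A Cantor scheme with
  centres at condensation points of \<open>D\<close>, in the manner of Kuratowski and Mycielski, therefore yields
  one Cantor set that has both properties at every precision (\<open>mycielski_cantor_set\<close>). A constant
  sequence of Cantor sets is increasing, so this set alone is uniformly chaotic.
\<close>

section \<open>Compact semigroups of maps\<close>

lemma compact_imp_closed_maps:
  fixes A :: "('a \<Rightarrow> 'b::metric_space) set"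
  assumes "compact A"
  shows "closed A"
proof -
  have "Hausdorff_space (euclidean :: ('a \<Rightarrow> 'b) topology)"
    by (metis Hausdorff_space_product_topology Hausdorff_space_euclidean euclidean_product_topology)
  moreover have "compactin euclidean A"
    using assms by simp
  ultimately show ?thesis
    using compactin_imp_closedin by (metis closed_closedin)
qed

text \<open>
  Zorn's lemma for inclusion: along a chain the intersection is nonempty by compactness, so it is
  enough that the family is stable under nonempty intersections.
\<close>

lemma minimal_closed_set_exists:
  fixes \<A> :: "'a::topological_space set set"
  assumes "compact K" and "A0 \<in> \<A>"
    and sub: "\<And>A. A \<in> \<A> \<Longrightarrow> A \<subseteq> K \<and> closed A \<and> A \<noteq> {}"
    and inter: "\<And>\<C>. \<C> \<subseteq> \<A> \<Longrightarrow> \<C> \<noteq> {} \<Longrightarrow> \<Inter>\<C> \<noteq> {} \<Longrightarrow> \<Inter>\<C> \<in> \<A>"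
  obtains M where "M \<in> \<A>" "\<forall>A\<in>\<A>. A \<subseteq> M \<longrightarrow> A = M"
proof -
  have "\<exists>m\<in>\<A>. \<forall>a\<in>\<A>. m \<supseteq> a \<longrightarrow> a = m"
  proof (rule predicate_Zorn)
    show "partial_order_on \<A> (relation_of (\<supseteq>) \<A>)"
      by (rule partial_order_on_relation_ofI) auto
  next
    fix \<C> assume ch: "\<C> \<in> Chains (relation_of (\<supseteq>) \<A>)"
    have cA: "\<C> \<subseteq> \<A>" and tot: "\<And>A B. A \<in> \<C> \<Longrightarrow> B \<in> \<C> \<Longrightarrow> A \<subseteq> B \<or> B \<subseteq> A"
      using ch by (auto simp: Chains_def relation_of_def)
    show "\<exists>u\<in>\<A>. \<forall>a\<in>\<C>. u \<subseteq> a"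
    proof (cases "\<C> = {}")
      case True
      then show ?thesis using assms(2) by blast
    next
      case False
      have fin: "K \<inter> \<Inter>F \<noteq> {}" if "finite F" "F \<subseteq> \<C>" for F
      proof (cases "F = {}")
        case True
        then show ?thesis using sub[OF assms(2)] by auto
      next
        case False
        have "\<exists>B\<in>F. \<forall>A\<in>F. B \<subseteq> A"
          using that(1) False that(2)
        proof (induction F rule: finite_ne_induct)
          case (singleton x)
          then show ?case by auto
        next
          case (insert x F)
          then obtain B where B: "B \<in> F" "\<forall>A\<in>F. B \<subseteq> A" by (meson insert_subset)
          have "x \<subseteq> B \<or> B \<subseteq> x" using tot insert.prems B(1) by blast
          then show ?case
          proof
            assume "x \<subseteq> B"
            then show ?case using B(2) by (intro bexI[of _ x]) auto
          next
            assume "B \<subseteq> x"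
            then show ?case using B by (intro bexI[of _ B]) auto
          qed
        qed
        then obtain B where B: "B \<in> F" "\<forall>A\<in>F. B \<subseteq> A" by blast
        then have "B \<subseteq> K \<inter> \<Inter>F" "B \<noteq> {}" using sub cA that(2) by blast+
        then show ?thesis by blast
      qed
      have "K \<inter> \<Inter>\<C> \<noteq> {}"
        by (rule compact_imp_fip[OF assms(1)]) (use sub cA fin in blast)+
      then have "\<Inter>\<C> \<in> \<A>" using inter[OF cA False] by blast
      then show ?thesis by blast
    qed
  qed
  then show ?thesis using that by blast
qed

lemma continuous_on_comp_right:
  fixes q :: "'a \<Rightarrow> 'b"
  shows "continuous_on A (\<lambda>p :: 'b \<Rightarrow> 'c::topological_space. p \<circ> q)"
  by (rule continuous_on_coordinatewise_then_product)
    (auto intro: continuous_on_subset[OF continuous_on_product_coordinates])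

text \<open>
  The Ellis--Numakura lemma. In the topology of pointwise convergence \<open>p \<mapsto> p \<circ> u\<close> is
  continuous for every map \<open>u\<close>, whether or not \<open>u\<close> is continuous. Hence for an element \<open>u\<close> of a
  minimal closed subsemigroup \<open>M\<close>, both \<open>M \<circ> u\<close> and the set of \<open>p\<close> with \<open>p \<circ> u = u\<close> are closed
  subsemigroups of \<open>M\<close>, and so both equal \<open>M\<close>.
\<close>

lemma compact_semigroup_idempotent:
  fixes A :: "('a \<Rightarrow> 'a::metric_space) set"
  assumes "compact A" "A \<noteq> {}" and semi: "\<And>p q. p \<in> A \<Longrightarrow> q \<in> A \<Longrightarrow> p \<circ> q \<in> A"
  obtains u where "u \<in> A" "u \<circ> u = u"
proof -
  define \<A> where "\<A> = {B. B \<subseteq> A \<and> closed B \<and> B \<noteq> {} \<and> (\<forall>p\<in>B. \<forall>q\<in>B. p \<circ> q \<in> B)}"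
  have mem: "A \<in> \<A>" using assms compact_imp_closed_maps by (auto simp: \<A>_def)
  have sub: "B \<subseteq> A \<and> closed B \<and> B \<noteq> {}" if "B \<in> \<A>" for B
    using that by (simp add: \<A>_def)
  have inter: "\<Inter>\<C> \<in> \<A>" if C: "\<C> \<subseteq> \<A>" "\<C> \<noteq> {}" "\<Inter>\<C> \<noteq> {}" for \<C>
  proof -
    have "\<Inter>\<C> \<subseteq> A" "closed (\<Inter>\<C>)"
      using C(1,2) unfolding \<A>_def by (blast, intro closed_Inter, blast)
    moreover have "\<forall>p\<in>\<Inter>\<C>. \<forall>q\<in>\<Inter>\<C>. p \<circ> q \<in> \<Inter>\<C>"
      using C(1) unfolding \<A>_def by blast
    ultimately show ?thesis using C(3) unfolding \<A>_def by blast
  qed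
  obtain M where M: "M \<in> \<A>" and min: "\<forall>B\<in>\<A>. B \<subseteq> M \<longrightarrow> B = M"
    by (rule minimal_closed_set_exists[OF assms(1), where \<A> = \<A>]; rule mem sub inter that)
  have Mc: "compact M" "closed M" and MA: "M \<subseteq> A"
    and Ms: "\<And>p q. p \<in> M \<Longrightarrow> q \<in> M \<Longrightarrow> p \<circ> q \<in> M"
    using M assms(1) compact_Int_closed[of A M] by (auto simp: \<A>_def Int_absorb1)
  obtain u where u: "u \<in> M" using M by (auto simp: \<A>_def)
  let ?B = "(\<lambda>p. p \<circ> u) ` M"
  have "closed ?B"
    by (intro compact_imp_closed_maps compact_continuous_image continuous_on_comp_right Mc)
  moreover have "?B \<subseteq> M" using Ms u by auto
  moreover have "\<forall>p\<in>?B. \<forall>q\<in>?B. p \<circ> q \<in> ?B"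
  proof clarify
    fix p q assume "p \<in> M" "q \<in> M"
    then have "p \<circ> (u \<circ> q) \<in> M" using Ms u by blast
    moreover have "p \<circ> u \<circ> (q \<circ> u) = (p \<circ> (u \<circ> q)) \<circ> u"
      by (simp add: comp_assoc)
    ultimately show "p \<circ> u \<circ> (q \<circ> u) \<in> ?B"
      by blast
  qed
  ultimately have "?B \<in> \<A>" using u MA by (auto simp: \<A>_def)
  then have "?B = M" by (intro mp[OF bspec[OF min]] \<open>?B \<subseteq> M\<close>)
  then have "u \<in> ?B" using u by simp
  then obtain p where "p \<in> M" "u = p \<circ> u" by blast
  then have p: "p \<in> M" "p \<circ> u = u" by simp_all
  let ?F = "{p \<in> M. p \<circ> u = u}"
  have "?F = M \<inter> (\<lambda>p. p \<circ> u) -` {u}" by auto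
  then have "closed ?F"
    using continuous_closed_preimage[OF continuous_on_comp_right Mc(2), of "{u}"]
      compact_imp_closed_maps[of "{u}"] by simp
  moreover have "\<forall>p\<in>?F. \<forall>q\<in>?F. p \<circ> q \<in> ?F"
    using Ms by (auto simp: comp_assoc)
  ultimately have "?F \<in> \<A>" using p MA by (auto simp: \<A>_def)
  then have "?F = M" by (intro mp[OF bspec[OF min]]) auto
  then show ?thesis using that u MA by blast
qed

lemma minimal_left_ideal_exists:
  fixes J :: "('a \<Rightarrow> 'a::metric_space) set"
  assumes "compact J" "J \<noteq> {}" and "\<And>p q. p \<in> E \<Longrightarrow> q \<in> J \<Longrightarrow> p \<circ> q \<in> J"
  obtains M where "M \<subseteq> J" "closed M" "M \<noteq> {}" "\<And>p q. p \<in> E \<Longrightarrow> q \<in> M \<Longrightarrow> p \<circ> q \<in> M"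
    and "\<And>B. B \<subseteq> M \<Longrightarrow> closed B \<Longrightarrow> B \<noteq> {} \<Longrightarrow> (\<And>p q. p \<in> E \<Longrightarrow> q \<in> B \<Longrightarrow> p \<circ> q \<in> B) \<Longrightarrow> B = M"
proof -
  define \<A> where "\<A> = {B. B \<subseteq> J \<and> closed B \<and> B \<noteq> {} \<and> (\<forall>p\<in>E. \<forall>q\<in>B. p \<circ> q \<in> B)}"
  have mem: "J \<in> \<A>" using assms compact_imp_closed_maps by (auto simp: \<A>_def)
  have sub: "B \<subseteq> J \<and> closed B \<and> B \<noteq> {}" if "B \<in> \<A>" for B
    using that by (simp add: \<A>_def)
  have inter: "\<Inter>\<C> \<in> \<A>" if C: "\<C> \<subseteq> \<A>" "\<C> \<noteq> {}" "\<Inter>\<C> \<noteq> {}" for \<C>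
  proof -
    have "\<Inter>\<C> \<subseteq> J" "closed (\<Inter>\<C>)"
      using C(1,2) unfolding \<A>_def by (blast, intro closed_Inter, blast)
    moreover have "\<forall>p\<in>E. \<forall>q\<in>\<Inter>\<C>. p \<circ> q \<in> \<Inter>\<C>"
      using C(1) unfolding \<A>_def by blast
    ultimately show ?thesis using C(3) unfolding \<A>_def by blast
  qed
  obtain M where M: "M \<in> \<A>" and min: "\<forall>B\<in>\<A>. B \<subseteq> M \<longrightarrow> B = M"
    by (rule minimal_closed_set_exists[OF assms(1), where \<A> = \<A>]; rule mem sub inter that)
  show ?thesis
  proof (rule that[of M])
    show "B = M" if "B \<subseteq> M" "closed B" "B \<noteq> {}" "\<And>p q. p \<in> E \<Longrightarrow> q \<in> B \<Longrightarrow> p \<circ> q \<in> B" for B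
    proof -
      have "B \<in> \<A>" using that M by (simp add: \<A>_def) blast
      then show ?thesis by (intro mp[OF bspec[OF min]] that(1))
    qed
  qed (use M in \<open>auto simp: \<A>_def\<close>)
qed

text \<open>
  Products of uncountably many spaces are not sequentially compact, so limits of iterates are taken
  as accumulation points; this form lets closed conditions pass to such a point directly.
\<close>

lemma compact_sequence_accumulates:
  fixes f :: "nat \<Rightarrow> 'a::topological_space"
  assumes "compact K" "\<And>k. f k \<in> K"
  obtains p where "p \<in> K"
    and "\<And>A. closed A \<Longrightarrow> eventually (\<lambda>k. f k \<in> A) sequentially \<Longrightarrow> p \<in> A"
proof -
  let ?G = "filtermap f sequentially"
  have "?G \<noteq> bot" "eventually (\<lambda>x. x \<in> K) ?G"
    using assms by (auto simp: filtermap_bot_iff eventually_filtermap)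
  then obtain p where p: "p \<in> K" "inf (nhds p) ?G \<noteq> bot"
    using assms(1) unfolding compact_filter by blast
  show ?thesis
  proof (rule that[OF p(1)])
    fix A assume A: "closed A" "eventually (\<lambda>k. f k \<in> A) sequentially"
    show "p \<in> A"
    proof (rule ccontr)
      assume "p \<notin> A"
      then have "eventually (\<lambda>x. x \<in> -A) (nhds p)"
        using A(1) by (intro eventually_nhds_in_open) auto
      then have "eventually (\<lambda>x. False) (inf (nhds p) ?G)"
        unfolding eventually_inf using A(2)
        by (intro exI[of _ "\<lambda>x. x \<in> -A"] exI[of _ "\<lambda>x. x \<in> A"]) (auto simp: eventually_filtermap)
      then show False using p(2) by (simp add: trivial_limit_def)
    qed
  qed
qed

section \<open>Limits of iterates on a compact system\<close>

text \<open>
  Requiring the maps to fix the points outside \<open>X\<close> makes this set compact while keeping it closed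
  under ordinary composition.
\<close>

definition self_maps :: "'a set \<Rightarrow> ('a \<Rightarrow> 'a) set" where
  "self_maps X = {f. \<forall>x. f x \<in> (if x \<in> X then X else {x})}"

definition iterate_on :: "'a set \<Rightarrow> ('a \<Rightarrow> 'a) \<Rightarrow> nat \<Rightarrow> 'a \<Rightarrow> 'a" where
  "iterate_on X T n = (\<lambda>x. if x \<in> X then (T ^^ n) x else x)"

text \<open>
  For \<open>N = 0\<close> this is the Ellis semigroup of the system. The intersection over all \<open>N\<close> consists of
  the limits along times that tend to infinity.
\<close>

definition tail_closure :: "'a::topological_space set \<Rightarrow> ('a \<Rightarrow> 'a) \<Rightarrow> nat \<Rightarrow> ('a \<Rightarrow> 'a) set" where
  "tail_closure X T N = closure (iterate_on X T ` {N..})"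

lemma self_maps_apply: "p \<in> self_maps X \<Longrightarrow> x \<in> X \<Longrightarrow> p x \<in> X"
  by (auto simp: self_maps_def split: if_splits dest: spec[of _ x])

lemma self_maps_outside: "p \<in> self_maps X \<Longrightarrow> x \<notin> X \<Longrightarrow> p x = x"
  by (auto simp: self_maps_def split: if_splits dest: spec[of _ x])

lemma compact_self_maps:
  fixes X :: "'a::metric_space set"
  assumes "compact X"
  shows "compact (self_maps X)"
proof -
  have "self_maps X = (\<Pi>\<^sub>E x\<in>UNIV. if x \<in> X then X else {x})"
    by (simp add: self_maps_def PiE_def extensional_def Pi_def)
  moreover have "compactin (product_topology (\<lambda>_. euclidean) UNIV)
      (\<Pi>\<^sub>E x\<in>UNIV. if x \<in> X then X else {x})"
    using assms by (auto simp: compactin_PiE)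
  ultimately show ?thesis
    by (simp add: euclidean_product_topology)
qed

lemma continuous_on_evaluation:
  assumes "continuous_on X g" "x \<in> X"
  shows "continuous_on (self_maps X) (\<lambda>p. g (p x))"
  by (rule continuous_on_compose2[OF assms(1)])
    (auto intro: continuous_on_subset[OF continuous_on_product_coordinates] self_maps_apply assms(2))

lemma closed_self_maps_relation:
  fixes X :: "'a::metric_space set" and g h :: "'a \<Rightarrow> 'b::metric_space"
  assumes "compact X" "continuous_on X g" "continuous_on X h" "x \<in> X" "x' \<in> X"
  shows "closed {p \<in> self_maps X. dist (g (p x)) (h (p x')) \<le> e}"
proof -
  have "continuous_on (self_maps X) (\<lambda>p. dist (g (p x)) (h (p x')))"
    by (intro continuous_on_dist continuous_on_evaluation assms)
  then have "closed (self_maps X \<inter> (\<lambda>p. dist (g (p x)) (h (p x'))) -` {..e})"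
    by (intro continuous_closed_preimage compact_imp_closed_maps compact_self_maps assms) auto
  then show ?thesis
    by (simp add: vimage_def Int_def)
qed

lemma continuous_on_comp_left:
  fixes f :: "'a::topological_space \<Rightarrow> 'a"
  assumes "continuous_on X f"
  shows "continuous_on (self_maps X) (\<lambda>p. f \<circ> p)"
proof (rule continuous_on_coordinatewise_then_product)
  fix i
  show "continuous_on (self_maps X) (\<lambda>p. (f \<circ> p) i)"
  proof (cases "i \<in> X")
    case True
    then show ?thesis using continuous_on_evaluation[OF assms] by simp
  next
    case False
    then have "(f \<circ> p) i = f i" if "p \<in> self_maps X" for p
      using that by (auto simp: self_maps_def dest: spec[of _ i])
    then show ?thesis using continuous_on_cong by (metis (no_types, lifting) continuous_on_const)
  qed
qed

lemma tail_closure_subset: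
  assumes "p \<in> tail_closure X T N" "closed A" "\<And>n. N \<le> n \<Longrightarrow> iterate_on X T n \<in> A"
  shows "p \<in> A"
  using closure_minimal[of "iterate_on X T ` {N..}" A] assms by (auto simp: tail_closure_def)

lemma tail_closure_approximation:
  fixes X :: "'a::metric_space set"
  assumes "p \<in> tail_closure X T N" "finite F" "F \<subseteq> X" "0 < e"
  shows "\<exists>n\<ge>N. \<forall>x\<in>F. dist ((T ^^ n) x) (p x) < e"
proof (rule ccontr)
  assume neg: "\<not> ?thesis"
  let ?U = "\<Inter>x\<in>F. {q. dist (q x) (p x) < e}"
  have op: "open {q :: 'a \<Rightarrow> 'a. dist (q x) (p x) < e}" for x
    by (intro open_Collect_less continuous_on_dist continuous_on_const
        continuous_on_product_coordinates)
  have "open ?U" using assms(2) op by (intro open_INT) auto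
  then have "closed (- ?U)" by (rule closed_Compl)
  moreover have "iterate_on X T n \<in> - ?U" if "n \<ge> N" for n
    using neg that assms(3) by (force simp: iterate_on_def)
  ultimately have "p \<in> - ?U" using tail_closure_subset[OF assms(1)] by blast
  then show False using assms(4) by auto
qed

locale compact_system =
  fixes X :: "'a::metric_space set" and T :: "'a \<Rightarrow> 'a"
  assumes compX: "compact X" and contT: "continuous_on X T" and TX: "T ` X = X"
begin

lemma funpow_in_carrier: "x \<in> X \<Longrightarrow> (T ^^ n) x \<in> X"
  using TX by (induction n) auto

lemma continuous_on_funpow: "continuous_on X (T ^^ n)"
proof (induction n)
  case (Suc n)
  have "continuous_on X (T \<circ> (T ^^ n))"
    by (rule continuous_on_compose[OF Suc continuous_on_subset[OF contT]]) (use funpow_in_carrier in auto)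
  then show ?case by simp
qed (simp add: id_def)

lemma iterate_on_self_maps: "iterate_on X T n \<in> self_maps X"
  using funpow_in_carrier by (auto simp: self_maps_def iterate_on_def)

lemma continuous_on_iterate_on: "continuous_on X (iterate_on X T n)"
  using continuous_on_funpow continuous_on_cong[of X X "iterate_on X T n" "T ^^ n"]
  by (simp add: iterate_on_def)

lemma iterate_on_comp: "iterate_on X T m \<circ> iterate_on X T n = iterate_on X T (m + n)"
  using funpow_in_carrier by (auto simp: iterate_on_def fun_eq_iff funpow_add)

lemma iterate_on_in_tail_closure: "N \<le> n \<Longrightarrow> iterate_on X T n \<in> tail_closure X T N"
  unfolding tail_closure_def by (meson atLeast_iff closure_subset imageI subset_iff)

lemma tail_closure_self_maps: "tail_closure X T N \<subseteq> self_maps X"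
  using tail_closure_subset[OF _ compact_imp_closed_maps[OF compact_self_maps[OF compX]]]
    iterate_on_self_maps by blast

lemma closed_tail_closure: "closed (tail_closure X T N)"
  by (simp add: tail_closure_def)

text \<open>
  The iterates are continuous on \<open>X\<close>, but their limits need not be. So the left factor is first an
  iterate, where \<open>q\<close> may be approximated; afterwards the left factor is approximated, which is always
  possible in the pointwise topology.
\<close>

lemma tail_closure_comp:
  assumes "p \<in> tail_closure X T 0" "q \<in> tail_closure X T N"
  shows "p \<circ> q \<in> tail_closure X T N"
proof -
  have step: "iterate_on X T n \<circ> q \<in> tail_closure X T N" for n
  proof -
    have "closed (self_maps X \<inter> (\<lambda>q. iterate_on X T n \<circ> q) -` tail_closure X T N)"
      by (intro continuous_closed_preimage continuous_on_comp_left continuous_on_iterate_on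
          closed_tail_closure compact_imp_closed_maps compact_self_maps compX)
    moreover have "iterate_on X T m
        \<in> self_maps X \<inter> (\<lambda>q. iterate_on X T n \<circ> q) -` tail_closure X T N" if "N \<le> m" for m
      using iterate_on_self_maps iterate_on_in_tail_closure[of N "n + m"] that
      by (simp add: iterate_on_comp)
    ultimately show ?thesis
      using tail_closure_subset[OF assms(2)] by blast
  qed
  have "closed (UNIV \<inter> (\<lambda>p. p \<circ> q) -` tail_closure X T N)"
    by (intro continuous_closed_preimage continuous_on_comp_right closed_tail_closure) auto
  from tail_closure_subset[OF assms(1) this] show ?thesis
    using step by auto
qed

lemma tail_closure_commutes:
  assumes "p \<in> tail_closure X T 0"
  shows "p \<circ> iterate_on X T 1 = iterate_on X T 1 \<circ> p"
proof
  fix x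
  show "(p \<circ> iterate_on X T 1) x = (iterate_on X T 1 \<circ> p) x"
  proof (cases "x \<in> X")
    case False
    moreover have "p x = x"
      by (rule self_maps_outside[OF subsetD[OF tail_closure_self_maps assms] False])
    ultimately show ?thesis by (simp add: iterate_on_def)
  next
    case True
    have "closed {p \<in> self_maps X. dist (id (p (T x))) (T (p x)) \<le> 0}"
      using True TX by (intro closed_self_maps_relation compX contT continuous_on_id') auto
    moreover have "iterate_on X T n (T x) = T (iterate_on X T n x)" for n
      using True TX by (auto simp: iterate_on_def funpow_swap1)
    ultimately have "p \<in> {p \<in> self_maps X. dist (id (p (T x))) (T (p x)) \<le> 0}"
      by (intro tail_closure_subset[OF assms]) (simp_all add: iterate_on_self_maps)
    then have "p (T x) = T (p x)"
      by simp
    moreover have "p x \<in> X"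
      by (rule self_maps_apply[OF subsetD[OF tail_closure_self_maps assms] True])
    ultimately show ?thesis using True by (simp add: iterate_on_def)
  qed
qed


lemma closed_agreement:
  fixes g h :: "'a \<Rightarrow> 'b::metric_space"
  assumes "continuous_on X g" "continuous_on X h" "x \<in> X" "x' \<in> X"
  shows "closed {p \<in> self_maps X. g (p x) = h (p x')}"
  using closed_self_maps_relation[OF compX assms, of 0] by simp

lemma compact_closed_subset: "closed A \<Longrightarrow> A \<subseteq> tail_closure X T N \<Longrightarrow> compact A"
  using compact_Int_closed[OF compact_self_maps[OF compX], of A] tail_closure_self_maps[of N]
  by (metis inf.absorb2 order_trans)

lemma tail_closure_in_carrier: "p \<in> tail_closure X T N \<Longrightarrow> x \<in> X \<Longrightarrow> p x \<in> X"
  by (rule self_maps_apply[OF subsetD[OF tail_closure_self_maps]])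

lemma iterates_accumulate:
  obtains p where "p \<in> self_maps X"
    "\<And>A. closed A \<Longrightarrow> eventually (\<lambda>k. iterate_on X T (n k) \<in> A) sequentially \<Longrightarrow> p \<in> A"
  using compact_sequence_accumulates[OF compact_self_maps[OF compX], of "\<lambda>k. iterate_on X T (n k)"]
    iterate_on_self_maps by blast

text \<open>
  If \<open>M\<close> is a minimal left ideal, then \<open>T \<circ> M\<close> is again a closed left ideal, because \<open>T\<close> commutes
  with every limit of its iterates. Hence \<open>T \<circ> M = M\<close>, and the closed set \<open>M x\<close> is invariant, so by
  minimality of the system it contains \<open>x\<close>.
\<close>

lemma minimal_left_ideal_transitive:
  assumes min: "\<And>A. A \<subseteq> X \<Longrightarrow> closed A \<Longrightarrow> A \<noteq> {} \<Longrightarrow> T ` A = A \<Longrightarrow> A = X"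
    and M: "M \<subseteq> tail_closure X T 0" "closed M" "M \<noteq> {}"
      "\<And>p q. p \<in> tail_closure X T 0 \<Longrightarrow> q \<in> M \<Longrightarrow> p \<circ> q \<in> M"
    and minM: "\<And>B. B \<subseteq> M \<Longrightarrow> closed B \<Longrightarrow> B \<noteq> {} \<Longrightarrow>
      (\<And>p q. p \<in> tail_closure X T 0 \<Longrightarrow> q \<in> B \<Longrightarrow> p \<circ> q \<in> B) \<Longrightarrow> B = M"
    and "x \<in> X"
  shows "\<exists>p\<in>M. p x = x"
proof -
  let ?t = "iterate_on X T 1" and ?E = "tail_closure X T 0"
  have t: "?t \<in> ?E" by (rule iterate_on_in_tail_closure) simp
  have compM: "compact M" by (rule compact_closed_subset[OF M(2,1)])
  have "(\<lambda>p. ?t \<circ> p) ` M = M"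
  proof (rule minM)
    show "(\<lambda>p. ?t \<circ> p) ` M \<subseteq> M" using M(4) t by blast
    have "M \<subseteq> self_maps X" using M(1) tail_closure_self_maps by (rule subset_trans)
    then show "closed ((\<lambda>p. ?t \<circ> p) ` M)"
      by (intro compact_imp_closed_maps compact_continuous_image compM
          continuous_on_subset[OF continuous_on_comp_left[OF continuous_on_iterate_on]])
    show "(\<lambda>p. ?t \<circ> p) ` M \<noteq> {}" using M(3) by simp
  next
    fix p q assume p: "p \<in> ?E" and "q \<in> (\<lambda>p. ?t \<circ> p) ` M"
    then obtain m where m: "m \<in> M" "q = ?t \<circ> m" by (elim imageE)
    have "p \<circ> q = ?t \<circ> (p \<circ> m)"
      unfolding m(2) comp_assoc[symmetric] tail_closure_commutes[OF p] by (rule refl)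
    then show "p \<circ> q \<in> (\<lambda>p. ?t \<circ> p) ` M" using M(4)[OF p m(1)] by blast
  qed
  moreover have "T (p x) = (?t \<circ> p) x" if "p \<in> M" for p
    using tail_closure_in_carrier[OF subsetD[OF M(1) that] assms(7)] by (simp add: iterate_on_def)
  then have "T ` (\<lambda>p. p x) ` M = (\<lambda>p. p x) ` (\<lambda>p. ?t \<circ> p) ` M"
    unfolding image_image by (rule image_cong[OF refl])
  ultimately have inv: "T ` (\<lambda>p. p x) ` M = (\<lambda>p. p x) ` M" by simp
  have "compact ((\<lambda>p. p x) ` M)"
    by (intro compact_continuous_image compM
        continuous_on_subset[OF continuous_on_product_coordinates]) simp
  then have "(\<lambda>p. p x) ` M = X"
    by (intro min inv compact_imp_closed)
      (use M(3) tail_closure_in_carrier[OF subsetD[OF M(1)] assms(7)] in auto)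
  then have "x \<in> (\<lambda>p. p x) ` M" using assms(7) by simp
  then obtain p where "p \<in> M" "x = p x" by (elim imageE)
  then show ?thesis by (intro bexI[of _ p]) simp_all
qed

end

section \<open>Lifting a rigid and proximal set through a factor map\<close>

locale factor_map = compact_system X T
  for X :: "'a::metric_space set" and T :: "'a \<Rightarrow> 'a" +
  fixes S :: "'b::metric_space \<Rightarrow> 'b" and \<pi> :: "'a \<Rightarrow> 'b"
  assumes contpi: "continuous_on X \<pi>"
    and equivariant: "\<And>x. x \<in> X \<Longrightarrow> \<pi> (T x) = S (\<pi> x)"
begin

lemma equivariant_funpow: "x \<in> X \<Longrightarrow> \<pi> ((T ^^ n) x) = (S ^^ n) (\<pi> x)"
  by (induction n) (simp_all add: equivariant funpow_in_carrier)

lemma tail_closure_respects_fibres: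
  assumes "p \<in> tail_closure X T N" "x \<in> X" "x' \<in> X" "\<pi> x = \<pi> x'"
  shows "\<pi> (p x) = \<pi> (p x')"
proof -
  have "p \<in> {p \<in> self_maps X. \<pi> (p x) = \<pi> (p x')}"
    by (rule tail_closure_subset[OF assms(1) closed_agreement[OF contpi contpi assms(2,3)]])
      (use assms iterate_on_self_maps in \<open>simp add: iterate_on_def equivariant_funpow\<close>)
  then show ?thesis by simp
qed

text \<open>
  The limits whose induced action on \<open>Y\<close> fixes \<open>C\<close> pointwise form a compact semigroup. It is
  nonempty because the iterates along the rigidity times of \<open>C\<close> accumulate. These times tend to
  infinity, which places \<open>u\<close> in every tail closure.
\<close>

lemma rigid_idempotent:
  assumes s: "\<And>y. y \<in> C \<Longrightarrow> s y \<in> X \<and> \<pi> (s y) = y" and "rigid_set S C"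
  obtains u where "\<And>N. u \<in> tail_closure X T N" "u \<circ> u = u" "\<And>y. y \<in> C \<Longrightarrow> \<pi> (u (s y)) = y"
proof -
  obtain n where n: "filterlim n at_top sequentially" "\<And>y. y \<in> C \<Longrightarrow> (\<lambda>k. (S ^^ n k) y) \<longlonglongrightarrow> y"
    using assms(2) unfolding rigid_set_def by blast
  define R where "R = (\<Inter>N. tail_closure X T N) \<inter> (\<Inter>y\<in>C. {p \<in> self_maps X. \<pi> (p (s y)) = y})"
  have R: "p \<in> R \<longleftrightarrow> (\<forall>N. p \<in> tail_closure X T N) \<and> (\<forall>y\<in>C. \<pi> (p (s y)) = y)" for p
    using tail_closure_self_maps unfolding R_def by blast
  have "closed R"
    unfolding R_def using s
    by (intro closed_Int closed_INT ballI closed_tail_closure closed_agreement contpi continuous_on_const) auto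
  then have "compact R" by (rule compact_closed_subset[where N=0]) (auto simp: R)
  moreover have "R \<noteq> {}"
  proof -
    obtain p where p: "p \<in> self_maps X"
      "\<And>A. closed A \<Longrightarrow> eventually (\<lambda>k. iterate_on X T (n k) \<in> A) sequentially \<Longrightarrow> p \<in> A"
      by (rule iterates_accumulate[of n]) (rule that)
    have "p \<in> tail_closure X T N" for N
    proof (rule p(2)[OF closed_tail_closure])
      have "eventually (\<lambda>k. N \<le> n k) sequentially" using n(1) by (simp add: filterlim_at_top)
      then show "eventually (\<lambda>k. iterate_on X T (n k) \<in> tail_closure X T N) sequentially"
        by (rule eventually_mono) (rule iterate_on_in_tail_closure)
    qed
    moreover have "\<pi> (p (s y)) = y" if y: "y \<in> C" for y
    proof -
      have "dist (\<pi> (p (s y))) y \<le> e" if "0 < e" for e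
      proof -
        have "p \<in> {p \<in> self_maps X. dist (\<pi> (p (s y))) y \<le> e}"
        proof (rule p(2))
          show "closed {p \<in> self_maps X. dist (\<pi> (p (s y))) y \<le> e}"
            using closed_self_maps_relation[OF compX contpi continuous_on_const, of "s y" "s y" y e] s[OF y]
            by simp
          have "eventually (\<lambda>k. dist ((S ^^ n k) y) y < e) sequentially"
            using n(2)[OF y] that by (rule tendstoD)
          then show "eventually (\<lambda>k. iterate_on X T (n k) \<in> {p \<in> self_maps X. dist (\<pi> (p (s y))) y \<le> e}) sequentially"
            by (rule eventually_mono)
              (use s[OF y] iterate_on_self_maps in \<open>simp add: iterate_on_def equivariant_funpow\<close>)
        qed
        then show ?thesis by simp
      qed
      then have "dist (\<pi> (p (s y))) y \<le> 0" by (rule field_le_epsilon) simp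
      then show ?thesis by simp
    qed
    ultimately have "p \<in> R" by (simp add: R)
    then show ?thesis by auto
  qed
  moreover have "p \<circ> q \<in> R" if "p \<in> R" "q \<in> R" for p q
  proof -
    have p: "p \<in> tail_closure X T N" "y \<in> C \<Longrightarrow> \<pi> (p (s y)) = y"
      and q: "q \<in> tail_closure X T N" "y \<in> C \<Longrightarrow> \<pi> (q (s y)) = y" for N y
      using that by (simp_all add: R)
    have "\<pi> (p (q (s y))) = y" if "y \<in> C" for y
      using tail_closure_respects_fibres[OF p(1) tail_closure_in_carrier[OF q(1)], of "s y" "s y"]
        s[OF that] p(2)[OF that] q(2)[OF that] by simp
    then show ?thesis using tail_closure_comp[OF p(1) q(1)] by (simp add: R)
  qed
  ultimately obtain u where "u \<in> R" "u \<circ> u = u"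
    by (rule compact_semigroup_idempotent)
  then show ?thesis by (intro that[of u]) (simp_all add: R)
qed

lemma collapsing_map:
  assumes s: "\<And>y. y \<in> C \<Longrightarrow> s y \<in> X \<and> \<pi> (s y) = y" and "uniformly_proximal_set S C"
  obtains q where "q \<in> tail_closure X T 0" "\<And>y y'. y \<in> C \<Longrightarrow> y' \<in> C \<Longrightarrow> \<pi> (q (s y)) = \<pi> (q (s y'))"
proof -
  have "\<exists>n. diameter ((S ^^ n) ` C) < 1 / real (Suc k)" for k
    using assms(2) unfolding uniformly_proximal_set_def by simp
  then obtain n where n: "\<And>k. diameter ((S ^^ n k) ` C) < 1 / real (Suc k)" by metis
  have bdd: "bounded ((S ^^ m) ` C)" for m
  proof (rule bounded_subset)
    show "bounded (\<pi> ` X)" by (intro compact_imp_bounded compact_continuous_image contpi compX)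
    show "(S ^^ m) ` C \<subseteq> \<pi> ` X"
    proof
      fix z assume "z \<in> (S ^^ m) ` C"
      then obtain y where "y \<in> C" "z = (S ^^ m) y" by (elim imageE)
      then have "z = \<pi> ((T ^^ m) (s y))" using s by (simp add: equivariant_funpow)
      then show "z \<in> \<pi> ` X" by (rule image_eqI) (use s \<open>y \<in> C\<close> funpow_in_carrier in simp)
    qed
  qed
  obtain q where q: "q \<in> self_maps X"
    "\<And>A. closed A \<Longrightarrow> eventually (\<lambda>k. iterate_on X T (n k) \<in> A) sequentially \<Longrightarrow> q \<in> A"
    by (rule iterates_accumulate[of n]) (rule that)
  have "q \<in> tail_closure X T 0"
    by (rule q(2)[OF closed_tail_closure]) (simp add: iterate_on_in_tail_closure)
  moreover have "\<pi> (q (s y)) = \<pi> (q (s y'))" if y: "y \<in> C" "y' \<in> C" for y y'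
  proof -
    have "dist (\<pi> (q (s y))) (\<pi> (q (s y'))) \<le> e" if "0 < e" for e
    proof -
      have "q \<in> {p \<in> self_maps X. dist (\<pi> (p (s y))) (\<pi> (p (s y'))) \<le> e}"
      proof (rule q(2))
        show "closed {p \<in> self_maps X. dist (\<pi> (p (s y))) (\<pi> (p (s y'))) \<le> e}"
          using closed_self_maps_relation[OF compX contpi contpi] s y by simp
        obtain K where K: "1 / real (Suc K) < e" using nat_approx_posE[OF \<open>0 < e\<close>] by blast
        have "dist ((S ^^ n k) y) ((S ^^ n k) y') \<le> e" if "K \<le> k" for k
        proof -
          have "dist ((S ^^ n k) y) ((S ^^ n k) y') \<le> diameter ((S ^^ n k) ` C)"
            by (intro diameter_bounded_bound bdd imageI y)
          also have "\<dots> \<le> 1 / real (Suc k)" using n[of k] by simp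
          also have "\<dots> \<le> 1 / real (Suc K)" using that by (intro divide_left_mono) auto
          finally show ?thesis using K by simp
        qed
        then have "\<forall>k\<ge>K. iterate_on X T (n k) \<in> {p \<in> self_maps X. dist (\<pi> (p (s y))) (\<pi> (p (s y'))) \<le> e}"
          using s y iterate_on_self_maps by (simp add: iterate_on_def equivariant_funpow)
        then show "eventually (\<lambda>k. iterate_on X T (n k)
            \<in> {p \<in> self_maps X. dist (\<pi> (p (s y))) (\<pi> (p (s y'))) \<le> e}) sequentially"
          unfolding eventually_sequentially by (rule exI)
      qed
      then show ?thesis by simp
    qed
    then have "dist (\<pi> (q (s y))) (\<pi> (q (s y'))) \<le> 0" by (rule field_le_epsilon) simp
    then show ?thesis by simp
  qed
  ultimately show ?thesis by (rule that)
qed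

text \<open>
  A common map \<open>u\<close> that fixes all lifted points and a common map \<open>w\<close> that identifies them are what
  makes arbitrary finite subsets of the lift rigid and proximal; lifting the points one by one would
  only control them separately.
\<close>

lemma coherent_lift:
  assumes min: "\<And>A. A \<subseteq> X \<Longrightarrow> closed A \<Longrightarrow> A \<noteq> {} \<Longrightarrow> T ` A = A \<Longrightarrow> A = X"
    and C: "C \<subseteq> \<pi> ` X" "C \<noteq> {}" and "rigid_set S C" "uniformly_proximal_set S C"
  obtains u w x z where "\<And>N. u \<in> tail_closure X T N" "w \<in> tail_closure X T 0"
    "\<And>y. y \<in> C \<Longrightarrow> x y \<in> X \<and> \<pi> (x y) = y \<and> u (x y) = x y \<and> w (x y) = z"
proof -
  let ?E = "tail_closure X T 0"
  have "\<forall>y\<in>C. \<exists>x. x \<in> X \<and> \<pi> x = y" using C(1) by auto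
  then obtain s where "\<forall>y\<in>C. s y \<in> X \<and> \<pi> (s y) = y" by (rule bchoice[THEN exE])
  then have s: "s y \<in> X \<and> \<pi> (s y) = y" if "y \<in> C" for y using that by simp
  obtain u where u: "\<And>N. u \<in> tail_closure X T N" "u \<circ> u = u" "\<And>y. y \<in> C \<Longrightarrow> \<pi> (u (s y)) = y"
    using rigid_idempotent[OF s assms(4)] by blast
  obtain q where q: "q \<in> ?E" "\<And>y y'. y \<in> C \<Longrightarrow> y' \<in> C \<Longrightarrow> \<pi> (q (s y)) = \<pi> (q (s y'))"
    using collapsing_map[OF s assms(5)] by blast
  have uu: "u (u x) = u x" for x using fun_cong[OF u(2), of x] by simp
  note inX = tail_closure_in_carrier
  \<comment> \<open>The left ideal of the maps that collapse \<open>C\<close>. Absorbing \<open>u\<close> on the right is built in, so that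
    moving a lifted point by \<open>u\<close> later does not change its image under \<open>w\<close>.\<close>
  define J where "J = ?E \<inter> (\<Inter>x\<in>X. {p \<in> self_maps X. p (u x) = p x})
    \<inter> (\<Inter>y\<in>C. \<Inter>y'\<in>C. {p \<in> self_maps X. \<pi> (p (s y)) = \<pi> (p (s y'))})"
  have J: "p \<in> J \<longleftrightarrow> p \<in> ?E \<and> (\<forall>x\<in>X. p (u x) = p x) \<and> (\<forall>y\<in>C. \<forall>y'\<in>C. \<pi> (p (s y)) = \<pi> (p (s y')))" for p
    using tail_closure_self_maps unfolding J_def by blast
  have cl1: "closed {p \<in> self_maps X. p (u x) = p x}" if "x \<in> X" for x
    using closed_agreement[OF continuous_on_id continuous_on_id inX[OF u(1) that] that] by simp
  have cl2: "closed {p \<in> self_maps X. \<pi> (p (s y)) = \<pi> (p (s y'))}" if "y \<in> C" "y' \<in> C" for y y'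
    using closed_agreement[OF contpi contpi] s that by simp
  have "closed J"
    unfolding J_def
    by (intro closed_Int closed_INT ballI closed_tail_closure cl1 cl2)
  then have "compact J" by (rule compact_closed_subset[where N=0]) (auto simp: J)
  moreover have "q \<circ> u \<in> J"
  proof -
    have "\<pi> (q (u (s y))) = \<pi> (q (s y))" if "y \<in> C" for y
      using tail_closure_respects_fibres[OF q(1) inX[OF u(1)], of "s y" "s y"] s[OF that] u(3)[OF that]
      by simp
    then have "\<pi> ((q \<circ> u) (s y)) = \<pi> ((q \<circ> u) (s y'))" if "y \<in> C" "y' \<in> C" for y y'
      using q(2)[OF that] that by simp
    moreover have "(q \<circ> u) (u x) = (q \<circ> u) x" for x by (simp add: uu)
    ultimately show ?thesis
      unfolding J by (intro conjI ballI tail_closure_comp[OF q(1) u(1)])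
  qed
  then have "J \<noteq> {}" by auto
  moreover have "p \<circ> m \<in> J" if "p \<in> ?E" "m \<in> J" for p m
  proof -
    have m: "m \<in> ?E" "x \<in> X \<Longrightarrow> m (u x) = m x"
      "y \<in> C \<Longrightarrow> y' \<in> C \<Longrightarrow> \<pi> (m (s y)) = \<pi> (m (s y'))" for x y y'
      using that(2) unfolding J by blast+
    have "\<pi> ((p \<circ> m) (s y)) = \<pi> ((p \<circ> m) (s y'))" if y: "y \<in> C" "y' \<in> C" for y y'
      unfolding comp_apply using s y
      by (intro tail_closure_respects_fibres[OF \<open>p \<in> ?E\<close>] inX[OF m(1)] m(3)) simp_all
    moreover have "(p \<circ> m) (u x) = (p \<circ> m) x" if "x \<in> X" for x
      using m(2)[OF that] by simp
    ultimately show ?thesis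
      unfolding J by (intro conjI ballI tail_closure_comp[OF that(1) m(1)])
  qed
  ultimately obtain M where M: "M \<subseteq> J" "closed M" "M \<noteq> {}"
    "\<And>p q. p \<in> ?E \<Longrightarrow> q \<in> M \<Longrightarrow> p \<circ> q \<in> M"
    and minM: "\<And>B. B \<subseteq> M \<Longrightarrow> closed B \<Longrightarrow> B \<noteq> {} \<Longrightarrow>
      (\<And>p q. p \<in> ?E \<Longrightarrow> q \<in> B \<Longrightarrow> p \<circ> q \<in> B) \<Longrightarrow> B = M"
    by (rule minimal_left_ideal_exists[where E = ?E]) blast+
  have ME: "M \<subseteq> ?E" using M(1) unfolding J_def by (rule subset_trans) blast
  have M_absorbs: "p (u x) = p x" if "p \<in> M" "x \<in> X" for p x
    using subsetD[OF M(1) that(1)] that(2) unfolding J by (elim conjE bspec)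
  have M_collapses: "\<pi> (p (s y)) = \<pi> (p (s y'))" if "p \<in> M" "y \<in> C" "y' \<in> C" for p y y'
  proof -
    have "\<forall>y\<in>C. \<forall>y'\<in>C. \<pi> (p (s y)) = \<pi> (p (s y'))"
      using subsetD[OF M(1) that(1)] unfolding J by (elim conjE)
    from bspec[OF bspec[OF this that(2)] that(3)] show ?thesis .
  qed
  have semi: "p \<circ> q \<in> M" if "p \<in> M" "q \<in> M" for p q
    using M(4) ME that by blast
  have compM: "compact M" by (rule compact_closed_subset[OF M(2) ME])
  \<comment> \<open>\<open>M \<circ> v\<close> is a closed left ideal inside \<open>M\<close>, hence all of \<open>M\<close>; so idempotents of \<open>M\<close> are right
    identities.\<close>
  have right_id: "p (v x) = p x" if v: "v \<in> M" "v \<circ> v = v" and p: "p \<in> M" for p v x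
  proof -
    have "(\<lambda>p. p \<circ> v) ` M = M"
    proof (rule minM)
      show "(\<lambda>p. p \<circ> v) ` M \<subseteq> M" using semi v(1) by blast
      show "closed ((\<lambda>p. p \<circ> v) ` M)"
        by (intro compact_imp_closed_maps compact_continuous_image compM continuous_on_comp_right)
      show "(\<lambda>p. p \<circ> v) ` M \<noteq> {}" using M(3) by simp
    next
      fix p q assume p: "p \<in> ?E" and "q \<in> (\<lambda>p. p \<circ> v) ` M"
      then obtain m where m: "m \<in> M" "q = m \<circ> v" by (elim imageE)
      have "p \<circ> q = (p \<circ> m) \<circ> v" unfolding m(2) comp_assoc by (rule refl)
      then show "p \<circ> q \<in> (\<lambda>p. p \<circ> v) ` M" using M(4)[OF p m(1)] by blast
    qed
    then obtain m where "p = m \<circ> v" using p by blast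
    then show ?thesis using fun_cong[OF v(2), of x] by simp
  qed
  have "\<exists>v. v \<in> M \<and> v \<circ> v = v \<and> v (s y) = s y" if y: "y \<in> C" for y
  proof -
    define A where "A = M \<inter> {p \<in> self_maps X. p (s y) = s y}"
    have A: "p \<in> A \<longleftrightarrow> p \<in> M \<and> p (s y) = s y" for p
      using ME tail_closure_self_maps unfolding A_def by blast
    have "closed {p \<in> self_maps X. p (s y) = s y}"
      using closed_agreement[OF continuous_on_id continuous_on_const, of "s y" "s y" "s y"] s[OF y] by simp
    then have "closed A" unfolding A_def by (intro closed_Int M(2))
    then have "compact A" by (rule compact_closed_subset[where N=0]) (use A ME in auto)
    moreover have "\<exists>p\<in>M. p (s y) = s y"
      by (rule minimal_left_ideal_transitive[OF min ME M(2,3,4) minM]) (use s y in simp_all)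
    then have "A \<noteq> {}" using A by auto
    moreover have "p \<circ> q \<in> A" if "p \<in> A" "q \<in> A" for p q
      using that semi by (simp add: A)
    ultimately obtain v where "v \<in> A" "v \<circ> v = v"
      by (rule compact_semigroup_idempotent)
    then show ?thesis by (intro exI[of _ v]) (simp add: A)
  qed
  then have "\<forall>y\<in>C. \<exists>v. v \<in> M \<and> v \<circ> v = v \<and> v (s y) = s y" by simp
  then obtain v where "\<forall>y\<in>C. v y \<in> M \<and> v y \<circ> v y = v y \<and> v y (s y) = s y"
    by (rule bchoice[THEN exE])
  then have v: "v y \<in> M" "v y \<circ> v y = v y" "v y (s y) = s y" if "y \<in> C" for y
    using that by simp_all
  obtain w where w: "w \<in> M" "w \<circ> w = w"
    using compact_semigroup_idempotent[OF compM M(3) semi] by blast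
  obtain y0 where y0: "y0 \<in> C" using C(2) by blast
  \<comment> \<open>All elements of \<open>M\<close> collapse \<open>C\<close>, so the choice of \<open>y0\<close> does not affect the fibre of \<open>z\<close>.\<close>
  define z where "z = w (s y0)"
  have zX: "z \<in> X" unfolding z_def using inX[OF subsetD[OF ME w(1)]] s[OF y0] by simp
  have "u (v y z) \<in> X \<and> \<pi> (u (v y z)) = y \<and> u (u (v y z)) = u (v y z) \<and> w (u (v y z)) = z"
    if y: "y \<in> C" for y
  proof (intro conjI)
    have vzX: "v y z \<in> X" by (rule inX[OF subsetD[OF ME v(1)[OF y]] zX])
    then show "u (v y z) \<in> X" by (rule inX[OF u(1)])
    have "\<pi> (v y z) = \<pi> (v y (s y0))"
      unfolding z_def using right_id[OF w v(1)[OF y]] by simp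
    also have "\<dots> = \<pi> (v y (s y))" by (rule M_collapses[OF v(1)[OF y] y0 y])
    also have "\<dots> = y" using v(3)[OF y] s[OF y] by simp
    finally have "\<pi> (u (v y z)) = \<pi> (u (s y))"
      by (intro tail_closure_respects_fibres[OF u(1) vzX]) (use s[OF y] in simp_all)
    then show "\<pi> (u (v y z)) = y" using u(3)[OF y] by simp
    show "u (u (v y z)) = u (v y z)" by (rule uu)
    have "w (u (v y z)) = w (v y z)" by (rule M_absorbs[OF w(1) vzX])
    also have "\<dots> = w z" by (rule right_id[OF v(1,2)[OF y] w(1)])
    also have "\<dots> = z" unfolding z_def using fun_cong[OF w(2), of "s y0"] by simp
    finally show "w (u (v y z)) = z" .
  qed
  note lifted = this
  show ?thesis
    by (rule that[OF u(1) subsetD[OF ME w(1)], of "\<lambda>y. u (v y z)" z]) (rule lifted)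
qed

end

section \<open>Cantor sets in compact spaces\<close>

text \<open>
  The points of \<open>D\<close> that have a neighbourhood meeting \<open>D\<close> in a countable set form a countable set:
  each is in one of countably many balls, coming from finite covers of \<open>X\<close>, that meet \<open>D\<close> in a
  countable set. All other points of \<open>D\<close> are condensation points.
\<close>

lemma condensation_points:
  fixes D :: "'a::metric_space set"
  assumes "compact X" "D \<subseteq> X" "uncountable D"
  obtains P where "P \<subseteq> D" "P \<noteq> {}" "\<And>x e. x \<in> P \<Longrightarrow> 0 < e \<Longrightarrow> \<exists>y\<in>P. y \<noteq> x \<and> dist x y < e"
proof -
  define P where "P = {x \<in> D. \<forall>e>0. uncountable (D \<inter> ball x e)}"
  have "\<exists>F. finite F \<and> X \<subseteq> (\<Union>c\<in>F. ball c (1 / Suc n))" for n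
  proof -
    have "X \<subseteq> (\<Union>c\<in>X. ball c (1 / Suc n))" by auto
    then show ?thesis
      by (metis (no_types, lifting) compactE_image[OF assms(1)] open_ball)
  qed
  then obtain F where F: "\<And>n. finite (F n)" "\<And>n. X \<subseteq> (\<Union>c\<in>F n. ball c (1 / Suc n))"
    by metis
  let ?I = "{(n, c). c \<in> F n \<and> countable (D \<inter> ball c (1 / Suc n))}"
  have "countable (SIGMA n:UNIV. F n)"
    using F(1) by (intro countable_SIGMA) (auto intro: countable_finite)
  then have "countable ?I" by (rule countable_subset[rotated]) auto
  then have cU: "countable (\<Union>(n, c)\<in>?I. D \<inter> ball c (1 / Suc n))"
    by (rule countable_UN) auto
  have "D - P \<subseteq> (\<Union>(n, c)\<in>?I. D \<inter> ball c (1 / Suc n))"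
  proof
    fix x assume x: "x \<in> D - P"
    then obtain e where e: "e > 0" "countable (D \<inter> ball x e)" by (auto simp: P_def)
    obtain n where n: "1 / real (Suc n) < e / 2" using e(1) by (meson half_gt_zero nat_approx_posE)
    obtain c where c: "c \<in> F n" "x \<in> ball c (1 / Suc n)" using F(2)[of n] x assms(2) by blast
    have "ball c (1 / Suc n) \<subseteq> ball x e"
    proof
      fix z assume "z \<in> ball c (1 / Suc n)"
      then have "dist c z < e / 2" "dist c x < e / 2" using c(2) n by auto
      then show "z \<in> ball x e" using dist_triangle[of x z c] dist_commute[of c x]
        unfolding mem_ball by linarith
    qed
    then have "countable (D \<inter> ball c (1 / Suc n))"
      using countable_subset[OF Int_mono[OF subset_refl] e(2)] by blast
    then show "x \<in> (\<Union>(n, c)\<in>?I. D \<inter> ball c (1 / Suc n))" using c x by blast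
  qed
  then have cnt: "countable (D - P)" using cU countable_subset by blast
  show ?thesis
  proof (rule that[of P])
    show "P \<subseteq> D" by (auto simp: P_def)
    show "P \<noteq> {}" using cnt assms(3) by auto
  next
    fix x and e :: real assume x: "x \<in> P" "0 < e"
    have "uncountable (D \<inter> ball x e)" using x by (auto simp: P_def)
    then have "\<not> D \<inter> ball x e \<subseteq> insert x (D - P)"
      using cnt countable_subset by (metis countable_insert)
    then show "\<exists>y\<in>P. y \<noteq> x \<and> dist x y < e" by auto
  qed
qed

lemma finite_separation:
  fixes S :: "'a::metric_space set"
  assumes "finite S"
  obtains d where "0 < d" "\<And>x y. x \<in> S \<Longrightarrow> y \<in> S \<Longrightarrow> x \<noteq> y \<Longrightarrow> d < dist x y"
proof -
  let ?A = "{dist x y |x y. x \<in> S \<and> y \<in> S \<and> x \<noteq> y}"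
  have "?A \<subseteq> (\<lambda>(x, y). dist x y) ` (S \<times> S)" by auto
  then have fin: "finite (insert 1 ?A)" using assms by (meson finite.insertI finite_SigmaI finite_imageI finite_subset)
  have pos: "0 < Min (insert 1 ?A)" using fin by (subst Min_gr_iff) auto
  show ?thesis
  proof (rule that[of "Min (insert 1 ?A) / 2"])
    show "0 < Min (insert 1 ?A) / 2" using pos by simp
    fix x y assume "x \<in> S" "y \<in> S" "x \<noteq> y"
    then have "Min (insert 1 ?A) \<le> dist x y" using fin by (intro Min_le) auto
    then show "Min (insert 1 ?A) / 2 < dist x y" using pos by linarith
  qed
qed

lemma compact_UNIV_nat_bool: "compact (UNIV :: (nat \<Rightarrow> bool) set)"
proof -
  have "compactin (product_topology (\<lambda>_. euclidean) UNIV) (\<Pi>\<^sub>E n\<in>(UNIV::nat set). (UNIV::bool set))"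
    unfolding compactin_PiE by (auto intro: finite_imp_compact)
  then show ?thesis by (simp add: euclidean_product_topology PiE_UNIV_domain)
qed

lemma eventually_nhds_agree:
  fixes a :: "nat \<Rightarrow> bool"
  shows "eventually (\<lambda>b. \<forall>i<n. b i = a i) (nhds a)"
proof -
  have "open (\<Inter>i<n. {b :: nat \<Rightarrow> bool. b i = a i})"
  proof (intro open_INT ballI)
    fix i
    have "open ((\<lambda>b :: nat \<Rightarrow> bool. b i) -` {a i})"
      by (intro open_vimage open_discrete continuous_on_product_coordinates)
    then show "open {b :: nat \<Rightarrow> bool. b i = a i}" by (simp add: vimage_def)
  qed auto
  from eventually_nhds_in_open[OF this, of a] show ?thesis
    by (auto elim: eventually_mono)
qed

lemma uncountable_UNIV_nat_bool: "uncountable (UNIV :: (nat \<Rightarrow> bool) set)"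
proof
  assume "countable (UNIV :: (nat \<Rightarrow> bool) set)"
  then have *: "range (from_nat_into (UNIV :: (nat \<Rightarrow> bool) set)) = UNIV"
    by (simp add: range_from_nat_into)
  obtain n where "from_nat_into (UNIV :: (nat \<Rightarrow> bool) set) n = (\<lambda>n. \<not> from_nat_into UNIV n n)"
    using * by (metis (no_types, lifting) UNIV_I imageE)
  then show False by metis
qed

lemma uncountable_cantor_set: "cantor_set C \<Longrightarrow> uncountable C"
  unfolding cantor_set_def homeomorphic_def homeomorphism_def
  using uncountable_UNIV_nat_bool by (metis countable_image)

text \<open>
  Stage \<open>n\<close> of the scheme has \<open>2 ^ n\<close> centres. They are indexed by infinite binary sequences whose
  first \<open>n\<close> entries matter, which avoids a separate index set for each stage. The next stage keeps
  each centre and adds a nearby one in \<open>P\<close>, the new bit \<open>a n\<close> deciding between the two.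
\<close>

lemma cantor_scheme_step:
  fixes x :: "(nat \<Rightarrow> bool) \<Rightarrow> 'a::metric_space"
  assumes P: "\<And>z e. z \<in> P \<Longrightarrow> 0 < e \<Longrightarrow> \<exists>y\<in>P. y \<noteq> z \<and> dist z y < e"
    and small: "\<And>F. finite F \<Longrightarrow> F \<subseteq> P \<Longrightarrow> \<exists>d>0. Q (\<Union>z\<in>F. cball z d)"
    and her: "\<And>A B. A \<subseteq> B \<Longrightarrow> Q B \<Longrightarrow> Q A"
    and x: "finite (range x)" "range x \<subseteq> P"
      "\<And>a b. (\<forall>i<n. a i = b i) \<Longrightarrow> x a = x b"
      "\<And>a b. \<not> (\<forall>i<n. a i = b i) \<Longrightarrow> 2 * r < dist (x a) (x b)"
    and r: "0 < r"
  obtains x' :: "(nat \<Rightarrow> bool) \<Rightarrow> 'a" and r'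
  where "finite (range x')" "range x' \<subseteq> P"
      "\<forall>a b. (\<forall>i<Suc n. a i = b i) \<longrightarrow> x' a = x' b"
      "\<forall>a b. \<not> (\<forall>i<Suc n. a i = b i) \<longrightarrow> 2 * r' < dist (x' a) (x' b)"
      "0 < r'" "r' \<le> r / 2" "\<forall>a. dist (x a) (x' a) + r' \<le> r"
      "Q (\<Union>a. cball (x' a) r')"
proof -
  have "\<exists>o'. \<forall>z\<in>P. o' z \<in> P \<and> o' z \<noteq> z \<and> dist z (o' z) < r / 2"
    using P[of _ "r / 2"] r by (intro bchoice) auto
  then obtain o' where o': "\<And>z. z \<in> P \<Longrightarrow> o' z \<in> P" "\<And>z. z \<in> P \<Longrightarrow> o' z \<noteq> z"
    "\<And>z. z \<in> P \<Longrightarrow> dist z (o' z) < r / 2"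
    by blast
  define x' where "x' a = (if a n then o' (x a) else x a)" for a
  have xP: "x a \<in> P" for a using x(2) by auto
  have "range x' \<subseteq> range x \<union> o' ` range x" by (auto simp: x'_def)
  then have fin: "finite (range x')" using x(1) by (meson finite_UnI finite_imageI finite_subset)
  have x'P: "range x' \<subseteq> P" using xP o' by (auto simp: x'_def)
  have near: "dist (x a) (x' a) < r / 2" for a using o'(3)[OF xP] r by (auto simp: x'_def)
  have ne: "x' a \<noteq> x' b" if "\<not> (\<forall>i<Suc n. a i = b i)" for a b
  proof (cases "\<forall>i<n. a i = b i")
    case True
    then have "a n \<noteq> b n" using that less_Suc_eq by blast
    moreover have "x a = x b" using x(3) True by blast
    ultimately show ?thesis using o'(2)[OF xP] by (auto simp: x'_def) metis
  next
    case False
    from x(4)[OF False] near[of a] near[of b] show ?thesis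
      using dist_triangle_half_l[of "x a" "x' a" "2*r" "x b"] r
        dist_triangle[of "x a" "x b" "x' a"] by (auto simp: dist_commute)
  qed
  obtain d where d: "0 < d" "\<And>y z. y \<in> range x' \<Longrightarrow> z \<in> range x' \<Longrightarrow> y \<noteq> z \<Longrightarrow> d < dist y z"
    using finite_separation[OF fin] by blast
  obtain d' where d': "0 < d'" "Q (\<Union>z\<in>range x'. cball z d')" using small[OF fin x'P] by blast
  define r' where "r' = min (r / 2) (min (d / 2) d')"
  have "x' a = x' b" if "\<forall>i<Suc n. a i = b i" for a b
    using that x(3)[of a b] by (auto simp: x'_def)
  moreover have "2 * r' < dist (x' a) (x' b)" if "\<not> (\<forall>i<Suc n. a i = b i)" for a b
    using d(2)[OF _ _ ne[OF that]] by (auto simp: r'_def min_def)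
  moreover have "dist (x a) (x' a) + r' \<le> r" for a
    using near[of a] by (auto simp: r'_def min_def)
  moreover have "Q (\<Union>a. cball (x' a) r')"
    by (rule her[OF _ d'(2)]) (auto simp: r'_def)
  moreover have "0 < r'" "r' \<le> r / 2"
    using r d(1) d'(1) by (auto simp: r'_def)
  ultimately show ?thesis
    using that[of x' r'] fin x'P by blast
qed

text \<open>
  Each stage of a Cantor scheme has finitely many centres, so the radius of stage \<open>n + 1\<close> can be
  chosen so small that the union of its balls has the property \<open>Q n\<close>. The Cantor set lies in this
  union and inherits \<open>Q n\<close>.
\<close>

lemma mycielski_cantor_set:
  fixes D X :: "'a::metric_space set" and Q :: "nat \<Rightarrow> 'a set \<Rightarrow> bool"
  assumes "compact X" "D \<subseteq> X" "uncountable D"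
    and her: "\<And>k A B. A \<subseteq> B \<Longrightarrow> Q k B \<Longrightarrow> Q k A"
    and small: "\<And>k F. finite F \<Longrightarrow> F \<subseteq> D \<Longrightarrow> \<exists>d>0. Q k (X \<inter> (\<Union>z\<in>F. cball z d))"
  obtains C where "cantor_set C" "C \<subseteq> X" "\<forall>k. Q k C"
proof -
  obtain P where P: "P \<subseteq> D" "P \<noteq> {}"
    "\<And>x e. x \<in> P \<Longrightarrow> 0 < e \<Longrightarrow> \<exists>y\<in>P. y \<noteq> x \<and> dist x y < e"
    using condensation_points[OF assms(1-3)] by blast
  obtain p where p: "p \<in> P" using P(2) by blast
  let ?I = "\<lambda>n (x :: (nat \<Rightarrow> bool) \<Rightarrow> 'a, r :: real). finite (range x) \<and> range x \<subseteq> P \<and>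
      (\<forall>a b. (\<forall>i<n. a i = b i) \<longrightarrow> x a = x b) \<and>
      (\<forall>a b. \<not> (\<forall>i<n. a i = b i) \<longrightarrow> 2 * r < dist (x a) (x b)) \<and> 0 < r \<and> r \<le> (1/2) ^ n"
  let ?R = "\<lambda>n (x :: (nat \<Rightarrow> bool) \<Rightarrow> 'a, r :: real) (x', r').
      (\<forall>a. dist (x a) (x' a) + r' \<le> r) \<and> Q n (X \<inter> (\<Union>a. cball (x' a) r'))"
  have "\<exists>f. \<forall>n. ?I n (f n) \<and> ?R n (f n) (f (Suc n))"
  proof (rule dependent_nat_choice)
    show "\<exists>s. ?I 0 s"
      by (rule exI[of _ "(\<lambda>_. p, 1)"]) (use p in auto)
  next
    fix s n assume "?I n s"
    then obtain x r where s: "s = (x, r)" and I: "?I n (x, r)" by (cases s) auto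
    have I': "finite (range x)" "range x \<subseteq> P"
      "\<And>a b. (\<forall>i<n. a i = b i) \<Longrightarrow> x a = x b"
      "\<And>a b. \<not> (\<forall>i<n. a i = b i) \<Longrightarrow> 2 * r < dist (x a) (x b)" "0 < r" "r \<le> (1/2) ^ n"
      using I by auto
    have step1: "\<exists>d>0. Q n (X \<inter> (\<Union>z\<in>F. cball z d))" if "finite F" "F \<subseteq> P" for F
      using small that P(1) by blast
    have step2: "Q n (X \<inter> A)" if "A \<subseteq> B" "Q n (X \<inter> B)" for A B
      by (rule her[OF _ that(2)]) (use that(1) in auto)
    obtain x' :: "(nat \<Rightarrow> bool) \<Rightarrow> 'a" and r'
      where *: "finite (range x')" "range x' \<subseteq> P"
      "\<forall>a b. (\<forall>i<Suc n. a i = b i) \<longrightarrow> x' a = x' b"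
      "\<forall>a b. \<not> (\<forall>i<Suc n. a i = b i) \<longrightarrow> 2 * r' < dist (x' a) (x' b)"
      "0 < r'" "r' \<le> r / 2" "\<forall>a. dist (x a) (x' a) + r' \<le> r"
      "Q n (X \<inter> (\<Union>a. cball (x' a) r'))"
      by (rule cantor_scheme_step[of P "\<lambda>A. Q n (X \<inter> A)" x n r];
          rule P(3) step1 step2 I'(1-5) that)
    have "r' \<le> (1/2) ^ Suc n" using *(6) I'(6) by simp
    then show "\<exists>y. ?I (Suc n) y \<and> ?R n s y"
      using *(1-5,7,8) s by (intro exI[of _ "(x', r')"]) simp
  qed
  then obtain f where f: "\<forall>n. ?I n (f n) \<and> ?R n (f n) (f (Suc n))" by (rule exE)
  define x where "x n = fst (f n)" for n
  define r where "r n = snd (f n)" for n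
  have fn: "f n = (x n, r n)" for n by (simp add: x_def r_def)
  note fI = conjunct1[OF spec[OF f], unfolded fn prod.case]
    and fR = conjunct2[OF spec[OF f], unfolded fn prod.case]
  note I' = conjunct2[OF fI]
  have I: "range (x n) \<subseteq> P" "(\<forall>i<n. a i = b i) \<Longrightarrow> x n a = x n b"
      "\<not> (\<forall>i<n. a i = b i) \<Longrightarrow> 2 * r n < dist (x n a) (x n b)" "0 < r n" "r n \<le> (1/2) ^ n" for n a b
    by (rule conjunct1[OF I'] mp[OF spec[OF spec[OF conjunct1[OF conjunct2[OF I']]]]]
        mp[OF spec[OF spec[OF conjunct1[OF conjunct2[OF conjunct2[OF I']]]]]]
        conjunct1[OF conjunct2[OF conjunct2[OF conjunct2[OF I']]]]
        conjunct2[OF conjunct2[OF conjunct2[OF conjunct2[OF I']]]], assumption?)+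
  have R: "dist (x n a) (x (Suc n) a) + r (Suc n) \<le> r n"
    "Q n (X \<inter> (\<Union>a. cball (x (Suc n) a) (r (Suc n))))" for n a
    by (rule spec[OF conjunct1[OF fR]] conjunct2[OF fR])+
  have nest: "dist (x n a) (x (n + k) a) + r (n + k) \<le> r n" for n k a
  proof (induction k)
    case (Suc k)
    then show ?case using R(1)[of "n + k" a] dist_triangle[of "x n a" "x (Suc (n + k)) a" "x (n + k) a"]
      by simp
  qed simp
  have inX: "x n a \<in> X" for n a using I(1) P(1) assms(2) by blast
  have lim: "\<exists>l\<in>X. (\<lambda>n. x n a) \<longlonglongrightarrow> l" for a
  proof -
    have "Cauchy (\<lambda>n. x n a)"
    proof (rule metric_CauchyI)
      fix e :: real assume "e > 0"
      then obtain N where N: "(1/2) ^ N < e / 2" by (metis half_gt_zero one_less_numeral_iff power_one_over reals_power_lt_ex semiring_norm(76))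
      have "dist (x N a) (x m a) < e / 2" if "m \<ge> N" for m
        using nest[of N a "m - N"] that I(4)[of m] I(5)[of N] N by simp
      then show "\<exists>M. \<forall>m\<ge>M. \<forall>n\<ge>M. dist (x m a) (x n a) < e"
        by (meson dist_triangle_half_r)
    qed
    moreover have "\<forall>n. x n a \<in> X" using inX by simp
    ultimately obtain l where "l \<in> X" "(\<lambda>n. x n a) \<longlonglongrightarrow> l"
      using completeE[OF compact_imp_complete[OF assms(1)]] by metis
    then show ?thesis by (rule bexI[rotated])
  qed
  \<comment> \<open>The nested balls shrink to a point \<open>h a\<close>. Separation of the balls makes \<open>h\<close> injective, and the
    radii \<open>r n \<le> (1/2) ^ n\<close> make it continuous; the Cantor space is compact, so \<open>h\<close> is an embedding.\<close>
  define h where "h a = lim (\<lambda>n. x n a)" for a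
  have h: "h a \<in> X" "(\<lambda>n. x n a) \<longlonglongrightarrow> h a" for a
    using lim[of a] by (auto simp: h_def limI)
  have close: "dist (x n a) (h a) \<le> r n" for n a
  proof (rule LIMSEQ_le_const2)
    show "(\<lambda>m. dist (x n a) (x m a)) \<longlonglongrightarrow> dist (x n a) (h a)"
      by (intro tendsto_intros h)
    show "\<exists>N. \<forall>m\<ge>N. dist (x n a) (x m a) \<le> r n"
    proof (intro exI[of _ n] allI impI)
      fix m assume "n \<le> m"
      then show "dist (x n a) (x m a) \<le> r n" using nest[of n a "m - n"] I(4)[of m] by simp
    qed
  qed
  have "inj h"
  proof (rule injI, rule ccontr)
    fix a b assume ab: "h a = h b" "a \<noteq> b"
    then obtain n where "a n \<noteq> b n" by auto
    then have "2 * r (Suc n) < dist (x (Suc n) a) (x (Suc n) b)" by (intro I(3)) auto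
    moreover have "dist (x (Suc n) a) (x (Suc n) b) \<le> 2 * r (Suc n)"
      using close[of "Suc n" a] close[of "Suc n" b] ab(1)
        dist_triangle2[of "x (Suc n) a" "x (Suc n) b" "h a"] by auto
    ultimately show False by simp
  qed
  moreover have "continuous_on UNIV h"
    unfolding continuous_on_def
  proof (intro ballI tendstoI)
    fix a :: "nat \<Rightarrow> bool" and e :: real assume "0 < e"
    then obtain n where n: "(1/2) ^ n < e / 2" by (metis half_gt_zero one_less_numeral_iff power_one_over reals_power_lt_ex semiring_norm(76))
    have "dist (h b) (h a) < e" if "\<forall>i<n. b i = a i" for b
      using close[of n a] close[of n b] I(2)[OF that] I(5)[of n] n
        dist_triangle3[of "h b" "h a" "x n a"] by auto
    then have "eventually (\<lambda>b. dist (h b) (h a) < e) (nhds a)"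
      using eventually_nhds_agree[where n=n and a=a] by (auto elim: eventually_mono)
    then show "eventually (\<lambda>b. dist (h b) (h a) < e) (at a within UNIV)"
      by (simp add: eventually_at_filter eventually_mono)
  qed
  ultimately obtain g where "homeomorphism UNIV (range h) h g"
    using homeomorphism_compact[OF compact_UNIV_nat_bool] by blast
  then have "cantor_set (range h)"
    unfolding cantor_set_def homeomorphic_def using homeomorphism_symD by blast
  moreover have "range h \<subseteq> X" using h(1) by auto
  moreover have "Q k (range h)" for k
    by (rule her[OF _ R(2)[of k]]) (use h(1) close[of "Suc k"] in \<open>auto simp: image_subset_iff\<close>)
  ultimately show ?thesis using that by blast
qed

section \<open>From finite sets to a uniformly chaotic set\<close>

text \<open>
  The return times are required to satisfy \<open>n \<ge> k\<close>, so that a single sequence of uniform return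
  times tending to infinity can be extracted for \<open>rigid_set\<close>.
\<close>

lemma uniformly_chaotic_cantor_set:
  assumes "cantor_set C" "C \<subseteq> X"
    and rigid: "\<And>k::nat. \<exists>n\<ge>k. n \<ge> 1 \<and> (\<forall>x\<in>C. dist ((T ^^ n) x) x < 1 / real (Suc k))"
    and prox: "\<And>k::nat. \<exists>n. \<forall>x\<in>C. \<forall>y\<in>C. dist ((T ^^ n) x) ((T ^^ n) y) \<le> 1 / real (Suc k)"
  shows "uniformly_chaotic_set X T C"
proof -
  have ur: "uniformly_rigid_set T C"
    unfolding uniformly_rigid_set_def
  proof (intro allI impI)
    fix e :: real assume "0 < e"
    then obtain k where k: "1 / real (Suc k) < e" using nat_approx_posE by blast
    obtain n where "n \<ge> 1" "\<forall>x\<in>C. dist ((T ^^ n) x) x < 1 / real (Suc k)" using rigid[of k] by blast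
    then show "\<exists>n\<ge>1. \<forall>x\<in>C. dist ((T ^^ n) x) x < e" using k by (intro exI[of _ n]) force
  qed
  have up: "uniformly_proximal_set T F" if "F \<subseteq> C" for F
    unfolding uniformly_proximal_set_def
  proof (intro allI impI)
    fix e :: real assume "0 < e"
    then obtain k where k: "1 / real (Suc k) < e" using nat_approx_posE by blast
    obtain n where n: "\<forall>x\<in>C. \<forall>y\<in>C. dist ((T ^^ n) x) ((T ^^ n) y) \<le> 1 / real (Suc k)"
      using prox[of k] by blast
    have "diameter ((T ^^ n) ` F) \<le> 1 / real (Suc k)"
    proof (cases "F = {}")
      case False
      have "dist a b \<le> 1 / real (Suc k)" if ab: "a \<in> (T ^^ n) ` F" "b \<in> (T ^^ n) ` F" for a b
        using n ab \<open>F \<subseteq> C\<close> by (elim imageE) blast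
      then show ?thesis
        using False unfolding diameter_def by (auto intro!: cSUP_least)
    qed (simp add: diameter_def)
    then show "\<exists>n. diameter ((T ^^ n) ` F) < e" using k by (intro exI[of _ n]) simp
  qed
  have "rigid_set T C"
  proof -
    let ?P = "\<lambda>k n. n \<ge> k \<and> (\<forall>x\<in>C. dist ((T ^^ n) x) x < 1 / real (Suc k))"
    have "\<exists>n. \<forall>k. ?P k (n k) \<and> n k \<le> n (Suc k)"
    proof (rule dependent_nat_choice[where P = ?P and Q = "\<lambda>_ n n'. n \<le> n'"])
      show "\<exists>n. ?P 0 n" using rigid[of 0] by blast
    next
      fix n k :: nat
      let ?m = "max (Suc k) n"
      obtain n' where n': "n' \<ge> ?m" "\<forall>x\<in>C. dist ((T ^^ n') x) x < 1 / real (Suc ?m)"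
        using rigid[of ?m] by blast
      have "1 / real (Suc ?m) \<le> 1 / real (Suc (Suc k))" by (intro divide_left_mono) auto
      then have "?P (Suc k) n' \<and> n \<le> n'" using n' by force
      then show "\<exists>n'. ?P (Suc k) n' \<and> n \<le> n'" by (rule exI)
    qed
    then obtain n where n: "\<forall>k. ?P k (n k) \<and> n k \<le> n (Suc k)" by (rule exE)
    have "mono n" using n by (intro incseq_SucI) simp
    moreover have "filterlim n at_top sequentially"
      by (rule filterlim_at_top_mono[OF filterlim_ident]) (use n in simp)
    moreover have "(\<lambda>k. (T ^^ n k) x) \<longlonglongrightarrow> x" if "x \<in> C" for x
    proof (rule metric_tendsto_imp_tendsto[OF LIMSEQ_inverse_real_of_nat])
      have "dist ((T ^^ n k) x) x < 1 / real (Suc k)" for k using n that by simp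
      then show "eventually (\<lambda>k. dist ((T ^^ n k) x) x \<le> dist (inverse (real (Suc k))) 0) sequentially"
        by (simp add: inverse_eq_divide less_imp_le)
    qed
    ultimately show ?thesis unfolding rigid_set_def by blast
  qed
  then show ?thesis
    unfolding uniformly_chaotic_set_def proximal_set_def using assms(1,2) ur up
    by (intro conjI exI[of _ "\<lambda>_. C"]) auto
qed

text \<open>
  At a fixed precision, returning and contracting at given times are open conditions on finitely many
  points, by continuity of the two iterates involved. Thus \<open>mycielski_cantor_set\<close> applies to the
  conjunction of both.
\<close>

lemma uncountable_rigid_proximal_imp_chaotic:
  fixes T :: "'a::metric_space \<Rightarrow> 'a"
  assumes "compact X" and cont: "\<And>n. continuous_on X (T ^^ n)" and "D \<subseteq> X" "uncountable D"
    and rigid: "\<And>F N e. finite F \<Longrightarrow> F \<subseteq> D \<Longrightarrow> 0 < e \<Longrightarrow> \<exists>n\<ge>N. \<forall>x\<in>F. dist ((T ^^ n) x) x < e"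
    and prox: "\<And>F e. finite F \<Longrightarrow> F \<subseteq> D \<Longrightarrow> 0 < e \<Longrightarrow> \<exists>n. \<forall>x\<in>F. dist ((T ^^ n) x) z < e"
  shows "\<exists>C. uniformly_chaotic_set X T C"
proof -
  define Q where "Q k A \<longleftrightarrow> (\<exists>n\<ge>k. n \<ge> 1 \<and> (\<forall>x\<in>A. dist ((T ^^ n) x) x < 1 / real (Suc k))) \<and>
    (\<exists>n. \<forall>x\<in>A. \<forall>y\<in>A. dist ((T ^^ n) x) ((T ^^ n) y) \<le> 1 / real (Suc k))" for k A
  have her: "Q k A" if "A \<subseteq> B" "Q k B" for k A B
    using that unfolding Q_def by (meson subsetD)
  have small: "\<exists>d>0. Q k (X \<inter> (\<Union>z\<in>F. cball z d))" if F: "finite F" "F \<subseteq> D" for k F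
  proof -
    let ?e = "1 / real (Suc k)"
    have e: "0 < ?e" by simp
    obtain n where n: "n \<ge> max k 1" "\<forall>x\<in>F. dist ((T ^^ n) x) x < ?e"
      using rigid[OF F e] by blast
    obtain m where m: "\<forall>x\<in>F. dist ((T ^^ m) x) z < ?e / 2"
      using prox[OF F, of "?e / 2"] by auto
    have near: "\<exists>d>0. \<forall>y\<in>X. dist x y \<le> d \<longrightarrow>
        dist ((T ^^ n) y) y < ?e \<and> dist ((T ^^ m) y) z < ?e / 2" if "x \<in> F" for x
    proof -
      have xX: "x \<in> X" using that F(2) assms(3) by blast
      have t: "((T ^^ j) \<longlongrightarrow> (T ^^ j) x) (at x within X)" for j
        using cont[of j] xX by (simp add: continuous_on_def)
      have "((\<lambda>y. dist ((T ^^ n) y) y) \<longlongrightarrow> dist ((T ^^ n) x) x) (at x within X)"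
        "((\<lambda>y. dist ((T ^^ m) y) z) \<longlongrightarrow> dist ((T ^^ m) x) z) (at x within X)"
        by (intro tendsto_intros t)+
      then have "eventually (\<lambda>y. dist ((T ^^ n) y) y < ?e) (at x within X)"
        "eventually (\<lambda>y. dist ((T ^^ m) y) z < ?e / 2) (at x within X)"
        using n(2) m that by (auto intro: order_tendstoD(2))
      then have "eventually (\<lambda>y. dist ((T ^^ n) y) y < ?e \<and> dist ((T ^^ m) y) z < ?e / 2) (at x within X)"
        by (rule eventually_conj)
      then obtain d where d: "d > 0" "\<forall>y\<in>X. y \<noteq> x \<and> dist y x < d \<longrightarrow>
          dist ((T ^^ n) y) y < ?e \<and> dist ((T ^^ m) y) z < ?e / 2"
        unfolding eventually_at by blast
      show ?thesis
      proof (intro exI[of _ "d / 2"] conjI ballI impI)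
        fix y assume y: "y \<in> X" "dist x y \<le> d / 2"
        have c: "y = x \<or> (y \<noteq> x \<and> dist y x < d)" using y(2) d(1) by (auto simp: dist_commute)
        show "dist ((T ^^ n) y) y < ?e" using c d(2) y(1) n(2) that by blast
        show "dist ((T ^^ m) y) z < ?e / 2" using c d(2) y(1) m that by blast
      qed (use d(1) in simp)
    qed
    then obtain \<delta> where \<delta>: "\<And>x. x \<in> F \<Longrightarrow> 0 < \<delta> x" "\<And>x y. x \<in> F \<Longrightarrow> y \<in> X \<Longrightarrow> dist x y \<le> \<delta> x \<Longrightarrow>
        dist ((T ^^ n) y) y < ?e \<and> dist ((T ^^ m) y) z < ?e / 2"
      by metis
    define d where "d = Min (insert 1 (\<delta> ` F))"
    have fin: "finite (insert 1 (\<delta> ` F))" using F(1) by simp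
    have dpos: "0 < d" unfolding d_def using fin \<delta>(1) by (subst Min_gr_iff) auto
    have dle: "d \<le> \<delta> x" if "x \<in> F" for x unfolding d_def using fin that by (intro Min_le) auto
    have good: "dist ((T ^^ n) y) y < ?e" "dist ((T ^^ m) y) z < ?e / 2"
      if y: "y \<in> X \<inter> (\<Union>z\<in>F. cball z d)" for y
    proof -
      obtain x where "x \<in> F" "y \<in> X" "dist x y \<le> d" using y by auto
      then show "dist ((T ^^ n) y) y < ?e" "dist ((T ^^ m) y) z < ?e / 2"
        using \<delta>(2)[of x y] dle[of x] by auto
    qed
    have "dist ((T ^^ m) a) ((T ^^ m) b) \<le> ?e"
      if ab: "a \<in> X \<inter> (\<Union>z\<in>F. cball z d)" "b \<in> X \<inter> (\<Union>z\<in>F. cball z d)" for a b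
      using good(2)[OF ab(1)] good(2)[OF ab(2)] dist_triangle2[of "(T ^^ m) a" "(T ^^ m) b" z]
      by linarith
    moreover have "k \<le> n" "1 \<le> n" using n(1) by simp_all
    ultimately have "Q k (X \<inter> (\<Union>z\<in>F. cball z d))"
      unfolding Q_def using good(1) by blast
    then show ?thesis using dpos by (intro exI[of _ d] conjI)
  qed
  obtain C where C: "cantor_set C" "C \<subseteq> X" "\<forall>k. Q k C"
    by (rule mycielski_cantor_set[where Q = Q, OF assms(1,3,4)]; rule her small that)
  have "uniformly_chaotic_set X T C"
    by (rule uniformly_chaotic_cantor_set[OF C(1,2)]) (use C(3) in \<open>simp_all only: Q_def\<close>)
  then show ?thesis by blast
qed

theorem theorem5p7:
  fixes X :: "'a::metric_space set" and T :: "'a \<Rightarrow> 'a"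
    and Y :: "'b::metric_space set" and S :: "'b \<Rightarrow> 'b"
    and \<pi> :: "'a \<Rightarrow> 'b"
  assumes "minimal_system X T"
    and "minimal_system Y S"
    and "system_hom X T Y S \<pi>"
    and "\<exists>K. uniformly_chaotic_set Y S K"
  shows "\<exists>K. uniformly_chaotic_set X T K"
proof -
  note minX = assms(1)[unfolded minimal_system_def]
  obtain T' where T: "compact X" "homeomorphism X X T T'"
    using conjunct1[OF minX] by (auto simp: dynamical_system_def)
  have min: "A = X" if "A \<subseteq> X" "closed A" "A \<noteq> {}" "T ` A = A" for A
    using conjunct2[OF minX] that by simp
  have hom: "continuous_on X \<pi>" "\<pi> ` X = Y" "\<And>x. x \<in> X \<Longrightarrow> \<pi> (T x) = S (\<pi> x)"
    using assms(3) by (simp_all add: system_hom_def)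
  interpret factor_map X T S \<pi>
    by unfold_locales
      (rule T(1) homeomorphism_cont1[OF T(2)] homeomorphism_image1[OF T(2)] hom | assumption)+
  obtain K where "uniformly_chaotic_set Y S K" using assms(4) by (rule exE)
  then obtain C' where K: "K \<subseteq> Y" "rigid_set S K" and K': "K = (\<Union>n. C' n)"
    "\<forall>n::nat. cantor_set (C' n)" "\<forall>n. uniformly_rigid_set S (C' n) \<and> uniformly_proximal_set S (C' n)"
    unfolding uniformly_chaotic_set_def by (elim conjE exE)
  define C where "C = C' 0"
  have C: "C \<subseteq> K" "cantor_set C" "uniformly_proximal_set S C"
    using K' by (auto simp: C_def)
  have "rigid_set S C" using K(2) C(1) unfolding rigid_set_def by (meson subsetD)
  moreover have "C \<subseteq> \<pi> ` X" using C(1) K(1) hom(2) by simp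
  moreover have unc: "uncountable C" by (rule uncountable_cantor_set[OF C(2)])
  then have "C \<noteq> {}" by auto
  ultimately obtain u w x z where u: "\<And>N. u \<in> tail_closure X T N" and w: "w \<in> tail_closure X T 0"
    and x: "\<And>y. y \<in> C \<Longrightarrow> x y \<in> X \<and> \<pi> (x y) = y \<and> u (x y) = x y \<and> w (x y) = z"
    using coherent_lift[OF min _ _ _ C(3)] by blast
  let ?D = "x ` C"
  have D: "d \<in> X" "u d = d" "w d = z" if "d \<in> ?D" for d using that x by auto
  show ?thesis
  proof (rule uncountable_rigid_proximal_imp_chaotic[OF T(1) continuous_on_funpow])
    show "?D \<subseteq> X" using D(1) by blast
    have "inj_on x C" using x by (intro inj_on_inverseI[of _ \<pi>]) simp
    then show "uncountable ?D" using unc by (simp add: countable_image_inj_eq)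
  next
    fix F N and e :: real assume F: "finite F" "F \<subseteq> ?D" "0 < e"
    have FX: "F \<subseteq> X" using F(2) D(1) by blast
    show "\<exists>n\<ge>N. \<forall>x\<in>F. dist ((T ^^ n) x) x < e"
      using tail_closure_approximation[OF u F(1) FX F(3), of N] F(2) D(2) by (metis subsetD)
  next
    fix F and e :: real assume F: "finite F" "F \<subseteq> ?D" "0 < e"
    have FX: "F \<subseteq> X" using F(2) D(1) by blast
    show "\<exists>n. \<forall>x\<in>F. dist ((T ^^ n) x) z < e"
      using tail_closure_approximation[OF w F(1) FX F(3)] F(2) D(3) by (metis subsetD)
  qed
qed

end
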